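(* For all integers $n\ge 2$ and $s\ge 0$, $\xi(n,s)\le s(n-1)+1$.
   Context: Sequences are finite words over an alphabet; a sequence on a given alphabet takes its letters from that alphabet (not every letter is required to appear). Two sequences are isomorphic if one is obtained from the other by a one-to-one renaming of letters. A sequence contains a copy of $u$ if some (not necessarily contiguous) subsequence of it is isomorphic to $u$; otherwise it is $u$-free. A sequence is $2$-sparse if no two adjacent letters are equal. For an integer $s\ge 0$, $u_s=xyxy\dots$ is the alternating sequence on two distinct letters $x,y$ of length $s+2$. A sequence on a given alphabet is $u_s$-saturated if it is $2$-sparse, $u_s$-free, and inserting any letter of the alphabet at any position (including the beginning or the end) violates $2$-sparsity or creates a copy of $u_s$. $\xi(n,s)$ denotes the minimum possible length of a $u_s$-saturated sequence on an alphabet of size $n$. *)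

theory Defs
  imports Main "HOL-Library.Sublist" "HOL-Library.Extended_Nat"
begin

definition isomorphic :: "'a list \<Rightarrow> 'b list \<Rightarrow> bool" where
  "isomorphic u v \<longleftrightarrow> (\<exists>f. inj_on f (set u) \<and> v = map f u)"

definition contains_copy :: "'a list \<Rightarrow> 'b list \<Rightarrow> bool" where
  "contains_copy w u \<longleftrightarrow> (\<exists>v. subseq v w \<and> isomorphic u v)"

text \<open>The alternating sequence of length \<open>s + 2\<close>, with the two letters taken to be 0 and 1.\<close>

definition alternating :: "nat \<Rightarrow> nat list" where
  "alternating s = map (\<lambda>i. i mod 2) [0..<s + 2]"

text \<open>2-sparsity is the library predicate \<open>distinct_adj\<close>.\<close>

definition saturated :: "'a set \<Rightarrow> nat \<Rightarrow> 'a list \<Rightarrow> bool" where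
  "saturated A s w \<longleftrightarrow>
     set w \<subseteq> A \<and> distinct_adj w \<and> \<not> contains_copy w (alternating s) \<and>
     (\<forall>a\<in>A. \<forall>xs ys. w = xs @ ys \<longrightarrow>
        \<not> distinct_adj (xs @ a # ys) \<or> contains_copy (xs @ a # ys) (alternating s))"

text \<open>The minimum length over the alphabet \<open>{..<n}\<close>; only the size of the alphabet matters.
  The value is an extended natural number so that it would be \<open>\<infinity>\<close>, rather than
  a junk number, if no saturated sequence existed; any finite upper bound therefore includes
  the existence of a saturated sequence.\<close>

definition xi :: "nat \<Rightarrow> nat \<Rightarrow> enat" where
  "xi n s = (INF w \<in> {w. saturated {..<n} s w}. enat (length w))"

end

theory Submission
  imports Defs
begin

text \<open>
  A saturated word is built by adding one letter of the alphabet at a time, at a cost of \<open>s\<close>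
  positions per letter. The one-letter word is saturated over its one-letter alphabet. Let \<open>w\<close> be
  saturated over \<open>A\<close>, let \<open>x\<close> be its last letter and let \<open>y\<close> be a new letter. Append to \<open>w\<close> the
  word \<open>t = yxyx\<dots>\<close> of length \<open>s\<close>. Then \<open>x t\<close> alternates between \<open>x\<close> and \<open>y\<close> and has length
  \<open>s + 1\<close>, one short of a forbidden copy, and \<open>w t\<close> is saturated over \<open>A \<union> {y}\<close>.

  No copy is created: two letters other than \<open>y\<close> alternate in \<open>w t\<close> no longer than in \<open>w\<close>, since
  \<open>w\<close> already ends in \<open>x\<close>; the longest alternation of \<open>x\<close> and \<open>y\<close> has length \<open>s + 1\<close>; and every
  occurrence of any other letter precedes every \<open>y\<close>.

  Every insertion is blocked. Letters of \<open>A\<close> inserted inside \<open>w\<close> are blocked because \<open>w\<close> is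
  saturated. A letter \<open>y\<close> before the final \<open>x\<close> of \<open>w\<close> completes \<open>y x t\<close> to a copy. A letter \<open>x\<close> or
  \<open>y\<close> inside or after \<open>t\<close> either equals a neighbour or lengthens \<open>x t\<close> to a copy. Any other letter
  \<open>a\<close> inserted there yields a copy because \<open>w a\<close>, which is 2-sparse, already contains one.
\<close>

section \<open>Copies of the alternating sequence\<close>

text \<open>Over two letters, 2-sparseness leaves no choice but to alternate. In this form a copy is
  recognised without tracking which letter comes first or the parity of its length.\<close>

lemma isomorphic_alternating_iff:
  "isomorphic (alternating s) v \<longleftrightarrow>
     length v = s + 2 \<and> distinct_adj v \<and> (\<exists>x y. x \<noteq> y \<and> set v \<subseteq> {x, y})"
proof
  have set_alt: "set (alternating s) = (\<lambda>i. i mod 2) ` {0..<s + 2}"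
    by (simp add: alternating_def del: upt_Suc)
  have letters: "set (alternating s) \<subseteq> {0, 1}" "{0, 1} \<subseteq> set (alternating s)"
    unfolding set_alt using image_mono[of "{0, 1}" "{0..<s + 2}" "\<lambda>i. i mod 2"] by auto
  {
    assume "isomorphic (alternating s) v"
    then obtain f where f: "inj_on f (set (alternating s))" "v = map f (alternating s)"
      by (auto simp: isomorphic_def)
    have "distinct_adj (alternating s)"
      by (auto simp: distinct_adj_conv_nth alternating_def simp del: upt_Suc) presburger
    then have "distinct_adj v"
      using f by (simp add: distinct_adj_map_iff)
    moreover have "f 0 \<noteq> f 1"
      using f(1) letters(2) by (auto simp: inj_on_def)
    moreover have "set v \<subseteq> {f 0, f 1}"
      using f(2) letters(1) by auto
    moreover have "length v = s + 2"
      using f(2) by (simp add: alternating_def)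
    ultimately show "length v = s + 2 \<and> distinct_adj v \<and> (\<exists>x y. x \<noteq> y \<and> set v \<subseteq> {x, y})"
      by blast
  next
    assume "length v = s + 2 \<and> distinct_adj v \<and> (\<exists>x y. x \<noteq> y \<and> set v \<subseteq> {x, y})"
    then obtain x y where v: "length v = s + 2" "distinct_adj v" "set v \<subseteq> {x, y}"
      by blast
    have step: "v ! Suc i \<noteq> v ! i" if "Suc i < length v" for i
      using v(2) that by (force simp: distinct_adj_conv_nth)
    have two: "v ! i \<in> {x, y}" if "i < length v" for i
      using v(3) that nth_mem by blast
    have period: "v ! i = v ! (i mod 2)" if "i < length v" for i
      using that
    proof (induction i rule: nat_less_induct)
      case (1 i)
      show ?case
      proof (cases "i < 2")
        case False
        then obtain j where j: "i = Suc (Suc j)"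
          by (metis add_2_eq_Suc le_Suc_ex not_less)
        have "v ! i = v ! j"
          using step[of j] step[of "Suc j"] two[of j] two[of "Suc j"] two[of i] 1(2) j by auto
        moreover have "v ! j = v ! (j mod 2)"
          using 1 j by (meson Suc_lessD lessI)
        ultimately show ?thesis
          using j by simp
      qed simp
    qed
    have "v = map (\<lambda>i. v ! i) (alternating s)"
      using v(1) period[symmetric]
      by (intro nth_equalityI) (auto simp: alternating_def simp del: upt_Suc)
    moreover have "inj_on (\<lambda>i. v ! i) {0, 1}"
      using step[of 0] v(1) by auto
    then have "inj_on (\<lambda>i. v ! i) (set (alternating s))"
      using letters(1) by (rule inj_on_subset)
    ultimately show "isomorphic (alternating s) v"
      unfolding isomorphic_def by blast
  }
qed

lemma contains_copy_alternatingI: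
  assumes "subseq v w" "length v = s + 2" "distinct_adj v" "x \<noteq> y" "set v \<subseteq> {x, y}"
  shows "contains_copy w (alternating s)"
  using assms unfolding contains_copy_def isomorphic_alternating_iff by blast

lemma contains_copy_mono:
  assumes "contains_copy w u" "subseq w w'"
  shows "contains_copy w' u"
  using assms unfolding contains_copy_def by (meson subseq_order.order_trans)

lemma distinct_adj_single_letter:
  assumes "distinct_adj xs" "set xs \<subseteq> {a}"
  shows "length xs \<le> 1"
proof (cases xs)
  case (Cons b ys)
  then show ?thesis using assms by (cases ys) auto
qed simp

section \<open>Adding one letter to the alphabet\<close>

lemma alternating_tail_exists:
  assumes "x \<noteq> y"
  shows "\<exists>t. length t = s \<and> distinct_adj (x # t) \<and> set t \<subseteq> {x, y}"
  using assms
proof (induction s arbitrary: x y)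
  case (Suc s)
  then obtain t where "length t = s" "distinct_adj (y # t)" "set t \<subseteq> {y, x}"
    by metis
  then show ?case
    using Suc.prems by (intro exI[of _ "y # t"]) auto
qed simp

text \<open>A copy in \<open>w0 x t\<close> splits into a part in \<open>w0 x\<close> and a part in \<open>t\<close>. If \<open>y\<close> is one of its two
  letters, the first part has at most one letter, and the second is too short. If not, the second
  part is at most a single \<open>x\<close>, and the \<open>x\<close> that ends \<open>w0 x\<close> can replace it.\<close>

lemma alternating_tail_creates_no_copy:
  assumes free: "\<not> contains_copy (w0 @ [x]) (alternating s)"
    and y: "y \<notin> set (w0 @ [x])"
    and t: "length t = s" "set t \<subseteq> {x, y}"
  shows "\<not> contains_copy (w0 @ x # t) (alternating s)"
proof
  assume "contains_copy (w0 @ x # t) (alternating s)"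
  then obtain v p q where v: "subseq v ((w0 @ [x]) @ t)" "length v = s + 2" "distinct_adj v"
      "p \<noteq> q" "set v \<subseteq> {p, q}"
    by (auto simp: contains_copy_def isomorphic_alternating_iff)
  then obtain v1 v2 where split: "v = v1 @ v2" "subseq v1 (w0 @ [x])" "subseq v2 t"
    using subseq_appendE[OF v(1)] by metis
  have adj: "distinct_adj v1" "distinct_adj v2"
    using v(3) split(1) by (auto dest: distinct_adj_appendD1 distinct_adj_appendD2)
  have sub: "set v1 \<subseteq> set (w0 @ [x])" "set v2 \<subseteq> {x, y}"
    using split(2,3) t(2) by (auto elim!: list_emb_set)
  have len2: "length v2 \<le> s"
    using list_emb_length[OF split(3)] t(1) by simp
  show False
  proof (cases "y \<in> {p, q}")
    case True
    then obtain r where "{p, q} = {y, r}" by blast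
    then have "set v1 \<subseteq> {r}"
      using sub(1) v(5) split(1) y by auto
    then have "length v1 \<le> 1"
      by (rule distinct_adj_single_letter[OF adj(1)])
    then show False
      using len2 v(2) split(1) by simp
  next
    case False
    then have "set v2 \<subseteq> {x}"
      using sub(2) v(5) split(1) by auto
    then have "v2 = [] \<or> v2 = [x]"
      using distinct_adj_single_letter[OF adj(2)] by (cases v2) auto
    then have "subseq v (w0 @ [x])"
    proof
      assume v2: "v2 = [x]"
      obtain b c where bc: "v1 = b @ c" "subseq b w0" "subseq c [x]"
        using subseq_appendE[OF split(2)] by metis
      \<comment> \<open>The last letter of \<open>v1\<close> differs from \<open>x\<close>, so it does not use the final \<open>x\<close>.\<close>
      have "c = []"
      proof (rule ccontr)
        assume "c \<noteq> []"
        then have "c = [x]"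
          using bc(3) by (cases c) (auto split: if_splits)
        then show False
          using v(3) split(1) v2 bc(1) by (simp add: distinct_adj_append_iff)
      qed
      then show "subseq v (w0 @ [x])"
        using bc split(1) v2 by (simp add: list_emb_append_mono)
    qed (use split in simp)
    then show False
      using contains_copy_alternatingI[OF _ v(2-5)] free by simp
  qed
qed

text \<open>The invariant behind the construction: the alternating tail adds the letter \<open>y\<close> at the cost
  of \<open>s\<close> positions and keeps the word saturated.\<close>

lemma saturated_append_alternating_tail:
  assumes sat: "saturated A s (w0 @ [x])"
    and y: "y \<notin> A"
    and t: "length t = s" "distinct_adj (x # t)" "set t \<subseteq> {x, y}"
  shows "saturated (insert y A) s (w0 @ x # t)"
proof -
  let ?w = "w0 @ [x]"
  have wA: "set ?w \<subseteq> A" and adj: "distinct_adj ?w"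
    and free: "\<not> contains_copy ?w (alternating s)"
    and ins: "\<And>a xs ys. a \<in> A \<Longrightarrow> ?w = xs @ ys \<Longrightarrow>
        \<not> distinct_adj (xs @ a # ys) \<or> contains_copy (xs @ a # ys) (alternating s)"
    using sat unfolding saturated_def by blast+
  have xy: "x \<noteq> y"
    using wA y by auto
  have blocked: "contains_copy (xs @ a # ys) (alternating s)"
    if a: "a \<in> insert y A" and eq: "?w @ t = xs @ ys" and sparse: "distinct_adj (xs @ a # ys)"
    for a xs ys
  proof -
    have inside_tail: ?thesis if us: "xs = ?w @ us" "t = us @ ys" for us
    proof (cases "a \<in> {x, y}")
      case True
      \<comment> \<open>The word \<open>x t\<close> with \<open>a\<close> inserted is still 2-sparse and now has length \<open>s + 2\<close>.\<close>
      show ?thesis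
      proof (rule contains_copy_alternatingI[OF _ _ _ xy])
        show "subseq (x # us @ a # ys) (xs @ a # ys)"
          using us by (simp add: subseq_drop_many)
        show "distinct_adj (x # us @ a # ys)"
          using sparse us distinct_adj_appendD2[of w0 "x # us @ a # ys"] by simp
        show "length (x # us @ a # ys) = s + 2" "set (x # us @ a # ys) \<subseteq> {x, y}"
          using us t True by auto
      qed
    next
      case False
      then have "distinct_adj (?w @ [a])"
        using adj by (subst distinct_adj_append_iff) auto
      then have "contains_copy (?w @ [a]) (alternating s)"
        using ins[of a ?w "[]"] a False by auto
      moreover have "subseq (?w @ [a]) (xs @ a # ys)"
        using us by (simp add: subseq_append' subseq_singleton_left)
      ultimately show ?thesis
        by (rule contains_copy_mono)
    qed
    consider us where "?w = xs @ us" "ys = us @ t" | us where "xs = ?w @ us" "t = us @ ys"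
      using eq unfolding append_eq_append_conv2 by metis
    then show ?thesis
    proof cases
      case (1 us)
      show ?thesis
      proof (cases "a = y")
        case False
        have "distinct_adj (xs @ a # us)"
          using sparse 1 distinct_adj_appendD1[of "xs @ a # us" t] by simp
        then have "contains_copy (xs @ a # us) (alternating s)"
          using ins[of a xs us] a False 1 by auto
        moreover have "subseq (xs @ a # us) (xs @ a # ys)"
          using 1 by (simp add: subseq_append' subseq_rev_drop_many)
        ultimately show ?thesis
          by (rule contains_copy_mono)
      next
        case True
        show ?thesis
        proof (cases us rule: rev_cases)
          case Nil
          then show ?thesis
            using inside_tail[of "[]"] 1 by simp
        next
          case (snoc vs z)
          then have "z = x"
            using 1 by simp
          show ?thesis
          proof (rule contains_copy_alternatingI[OF _ _ _ xy])
            show "subseq (y # x # t) (xs @ a # ys)"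
              using True 1 snoc \<open>z = x\<close> by (simp add: subseq_drop_many)
            show "length (y # x # t) = s + 2" "distinct_adj (y # x # t)"
                "set (y # x # t) \<subseteq> {x, y}"
              using t xy by auto
          qed
        qed
      qed
    qed (rule inside_tail)
  qed
  have "set (w0 @ x # t) \<subseteq> insert y A"
    using wA t(3) by auto
  moreover have "distinct_adj (w0 @ x # t)"
    using adj t(2) by (auto simp: distinct_adj_append_iff)
  moreover have "\<not> contains_copy (w0 @ x # t) (alternating s)"
    using wA y by (intro alternating_tail_creates_no_copy[OF free _ t(1,3)]) auto
  ultimately show ?thesis
    unfolding saturated_def
    by (metis append.assoc append_Cons append_Nil blocked)
qed

section \<open>The upper bound\<close>

lemma saturated_singleton: "saturated {a} s [a]"
proof -
  have "\<not> contains_copy [a] (alternating s)"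
    by (auto simp: contains_copy_def isomorphic_alternating_iff dest!: list_emb_length)
  then show ?thesis
    by (auto simp: saturated_def append_eq_Cons_conv Cons_eq_append_conv)
qed

lemma saturated_exists: "\<exists>w. saturated {..<Suc n} s w \<and> length w = s * n + 1"
proof (induction n)
  case 0
  then show ?case
    using saturated_singleton[of "0::nat" s] by (auto simp: lessThan_Suc)
next
  case (Suc n)
  then obtain w where w: "saturated {..<Suc n} s w" "length w = s * n + 1"
    by blast
  then obtain w0 x where w0: "w = w0 @ [x]"
    by (cases w rule: rev_cases) auto
  then have "x \<noteq> Suc n"
    using w(1) by (auto simp: saturated_def)
  then obtain t where t: "length t = s" "distinct_adj (x # t)" "set t \<subseteq> {x, Suc n}"
    using alternating_tail_exists[of x "Suc n" s] by blast
  have "saturated (insert (Suc n) {..<Suc n}) s (w0 @ x # t)"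
    using w(1) w0 by (intro saturated_append_alternating_tail[OF _ _ t]) auto
  then have "saturated {..<Suc (Suc n)} s (w0 @ x # t)"
    by (simp only: lessThan_Suc[of "Suc n"])
  moreover have "length (w0 @ x # t) = s * Suc n + 1"
    using w(2) w0 t(1) by simp
  ultimately show ?case
    by blast
qed

theorem lemma2p1:
  fixes n s :: nat
  assumes "n \<ge> 2"
  shows "xi n s \<le> enat (s * (n - 1) + 1)"
proof -
  obtain w where w: "saturated {..<n} s w" "length w = s * (n - 1) + 1"
    using saturated_exists[of "n - 1" s] assms by auto
  then have "xi n s \<le> enat (length w)"
    unfolding xi_def by (intro INF_lower) simp
  then show ?thesis
    using w(2) by simp
qed

end
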